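(* Let $\lambda$ be a nonzero real number. For every integer $n \geq 0$, \[ 2b_{n,\lambda}(x)-b_{n,\lambda}(x+1)=\sum_{k=0}^n \lambda^{n-k}S_1(n,k)x^k . \]
   Context: For a nonzero real $\lambda$, the degenerate ordered Bell polynomials $b_{n,\lambda}(x)$ are defined by the formal power series identity \[ \frac{1}{2-(1+\lambda t)^{1/\lambda}}(1+\lambda t)^{x/\lambda}=\sum_{n=0}^\infty b_{n,\lambda}(x)\frac{t^n}{n!}, \] where $(1+\lambda t)^{a/\lambda}=\exp\big(\tfrac{a}{\lambda}\log(1+\lambda t)\big)$. The (signed) Stirling numbers of the first kind $S_1(n,l)$ are defined by $x(x-1)\cdots(x-n+1)=\sum_{l=0}^n S_1(n,l)x^l$. *)

theory Defs
  imports "HOL-Computational_Algebra.Computational_Algebra"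
begin

unbundle fps_syntax

text \<open>
  The series \<open>(1 + \<lambda> t)\<^sup>a\<^sup>/\<^sup>\<lambda> = exp ((a/\<lambda>) log (1 + \<lambda> t))\<close> in the variable \<open>t\<close>.
  In the library, \<open>fps_ln 1\<close> is \<open>log (1 + t)\<close> and \<open>fps_exp c\<close> is \<open>exp (c t)\<close>.
  The parameter \<open>lam\<close> of the constants below is \<open>\<lambda>\<close>.  For \<open>lam = 0\<close> the
  values carry no meaning (division by 0 yields 0).
\<close>

definition degenerate_exp :: "real \<Rightarrow> real \<Rightarrow> real fps" where
  "degenerate_exp lam a = fps_exp (a / lam) oo (fps_ln 1 oo (fps_const lam * fps_X))"

definition degenerate_ordered_bell :: "nat \<Rightarrow> real \<Rightarrow> real \<Rightarrow> real" where
  "degenerate_ordered_bell n lam x =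
     fact n * (inverse (2 - degenerate_exp lam 1) * degenerate_exp lam x) $ n"

text \<open>The constant term of the denominator is 1, so \<open>inverse\<close> is a true inverse here.\<close>

lemma degenerate_exp_nth_0: "degenerate_exp lam a $ 0 = 1"
  by (simp add: degenerate_exp_def)

lemma bell_denominator_inverse:
  "(2 - degenerate_exp lam 1) * inverse (2 - degenerate_exp lam 1) = 1"
proof -
  have "(2 - degenerate_exp lam 1) $ 0 \<noteq> 0"
    by (simp add: degenerate_exp_nth_0)
  then show ?thesis
    by (rule inverse_mult_eq_1')
qed

lemma degenerate_ordered_bell_gf:
  "inverse (2 - degenerate_exp lam 1) * degenerate_exp lam x =
     Abs_fps (\<lambda>n. degenerate_ordered_bell n lam x / fact n)"
  by (rule fps_ext) (simp add: degenerate_ordered_bell_def)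

text \<open>
  Signed Stirling numbers of the first kind, as the coefficients of the falling factorial
  \<open>x (x - 1) \<dots> (x - n + 1)\<close>; the library's \<open>stirling\<close> is the unsigned version.
\<close>

definition stirling1 :: "nat \<Rightarrow> nat \<Rightarrow> int" where
  "stirling1 n l = coeff (\<Prod>i<n. [:- int i, 1:]) l"

lemma falling_factorial_eq_sum_stirling1:
  fixes x :: int
  shows "(\<Prod>i<n. x - int i) = (\<Sum>l\<le>n. stirling1 n l * x ^ l)"
proof -
  let ?p = "\<Prod>i<n. [:- int i, 1:]"
  have "degree ?p \<le> n"
    using degree_prod_sum_le[of "{..<n}" "\<lambda>i. [:- int i, 1:]"] by simp
  then have "poly ?p x = (\<Sum>l\<le>n. coeff ?p l * x ^ l)"
    unfolding poly_altdef
    by (intro sum.mono_neutral_left) (auto simp: coeff_eq_0)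
  then show ?thesis
    by (simp add: stirling1_def poly_prod algebra_simps)
qed

end

theory Submission
  imports Defs
begin

text \<open>
  Since \<open>e\<^sub>\<lambda>(x + 1) = e\<^sub>\<lambda>(1) e\<^sub>\<lambda>(x)\<close> for \<open>e\<^sub>\<lambda>(a) = (1 + \<lambda> t)\<^sup>a\<^sup>/\<^sup>\<lambda>\<close>, the generating
  function of the left-hand side is \<open>(2 - e\<^sub>\<lambda>(1)) e\<^sub>\<lambda>(x) / (2 - e\<^sub>\<lambda>(1)) = e\<^sub>\<lambda>(x)\<close>.
  By the binomial series its coefficient at \<open>t\<^sup>n/n!\<close> is \<open>\<lambda>\<^sup>n\<close> times the falling factorial
  of \<open>x/\<lambda>\<close>.
\<close>

text \<open>Both sides have constant term 1 and solve \<open>f' = c f / (1 + X)\<close>, which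
  determines \<open>f\<close>.\<close>

lemma fps_exp_compose_ln: "fps_exp c oo fps_ln 1 = fps_binomial (c :: 'a :: field_char_0)"
proof -
  have "fps_deriv (fps_exp c oo fps_ln 1) =
      fps_const c * (fps_exp c oo fps_ln 1) / (1 + fps_X)"
    by (simp add: fps_compose_deriv fps_ln_deriv fps_compose_mult_distrib fps_divide_unit)
  then show ?thesis
    using fps_binomial_ODE_unique'[of "fps_exp c oo fps_ln 1" c] by simp
qed

lemma degenerate_exp_conv_binomial:
  "degenerate_exp lam a = fps_binomial (a / lam) oo (fps_const lam * fps_X)"
  by (simp add: degenerate_exp_def fps_compose_assoc fps_exp_compose_ln)

lemma degenerate_exp_add: "degenerate_exp lam (a + b) = degenerate_exp lam a * degenerate_exp lam b"
  by (simp add: degenerate_exp_conv_binomial add_divide_distrib fps_binomial_add_mult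
      fps_compose_mult_distrib)

lemma degenerate_exp_nth: "degenerate_exp lam a $ n = lam ^ n * (a / lam gchoose n)"
  by (simp add: degenerate_exp_conv_binomial)

text \<open>Leaves the integers, since the falling factorial will be evaluated at the real number
  \<open>x / lam\<close>.\<close>

lemma stirling1_conv_coeff:
  "of_int (stirling1 n l) = coeff (\<Prod>i<n. [:- of_nat i, 1 :: 'a :: comm_ring_1:]) l"
  unfolding stirling1_def
  by (induction n arbitrary: l) (simp_all add: coeff_pCons split: nat.split)

lemma falling_factorial_conv_stirling1:
  fixes x :: "'a :: idom"
  shows "(\<Prod>i<n. x - of_nat i) = (\<Sum>l\<le>n. of_int (stirling1 n l) * x ^ l)"
proof -
  let ?p = "\<Prod>i<n. [:- of_nat i, 1 :: 'a:]"
  have "degree ?p \<le> n"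
    using degree_prod_sum_le[of "{..<n}" "\<lambda>i. [:- of_nat i, 1 :: 'a:]"] by simp
  then have "poly ?p x = (\<Sum>l\<le>n. coeff ?p l * x ^ l)"
    unfolding poly_altdef
    by (intro sum.mono_neutral_left) (auto simp: coeff_eq_0)
  then show ?thesis
    by (simp add: stirling1_conv_coeff poly_prod)
qed

theorem theorem2:
  fixes lam x :: real and n :: nat
  assumes "lam \<noteq> 0"
  shows "2 * degenerate_ordered_bell n lam x - degenerate_ordered_bell n lam (x + 1) =
    (\<Sum>k=0..n. lam ^ (n - k) * of_int (stirling1 n k) * x ^ k)"
proof -
  let ?e = "degenerate_exp lam" and ?i = "inverse (2 - degenerate_exp lam 1)"
  have "2 * (?i * ?e x) - ?i * ?e (x + 1) = ((2 - ?e 1) * ?i) * ?e x"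
    by (simp add: degenerate_exp_add algebra_simps)
  also have "\<dots> = ?e x"
    by (simp add: bell_denominator_inverse)
  finally have gf: "2 * (?i * ?e x) - ?i * ?e (x + 1) = ?e x" .
  have "2 * degenerate_ordered_bell n lam x - degenerate_ordered_bell n lam (x + 1) =
      fact n * (2 * (?i * ?e x) - ?i * ?e (x + 1)) $ n"
    by (simp add: degenerate_ordered_bell_def fps_numeral_fps_const right_diff_distrib)
  \<comment> \<open>The factor \<open>fact n\<close> cancels the denominator of
    \<open>x / lam gchoose n\<close>.\<close>
  also have "\<dots> = lam ^ n * (\<Prod>i<n. x / lam - of_nat i)"
    by (simp add: gf degenerate_exp_nth gbinomial_prod_rev atLeast0LessThan)
  also have "\<dots> = (\<Sum>k\<le>n. lam ^ n * (of_int (stirling1 n k) * (x / lam) ^ k))"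
    by (simp add: falling_factorial_conv_stirling1 sum_distrib_left)
  \<comment> \<open>As \<open>lam\<close> is nonzero and \<open>k\<close> is at most
    \<open>n\<close>, \<open>lam ^ n / lam ^ k\<close> is \<open>lam ^ (n - k)\<close>.\<close>
  also have "\<dots> = (\<Sum>k=0..n. lam ^ (n - k) * of_int (stirling1 n k) * x ^ k)"
    using assms by (intro sum.cong) (auto simp: power_divide power_diff)
  finally show ?thesis .
qed

end
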